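(* Let $(A_1,\ldots,A_d)$ be a family of real symmetric $n\times n$ matrices that is SDC. Then the following holds for almost every $(\mu,\theta)\in\mathbb{R}^d\times\mathbb{R}^d$: if $X\in\mathbb{R}^{n\times n}$ is an invertible matrix such that $X^TA(\mu)X$ and $X^TA(\theta)X$ are diagonal, then the matrices $X^TA_kX$ are diagonal for $k=1,\ldots,d$.
   Context: All matrices are real. A family $(A_1,\ldots,A_d)$ of real symmetric $n\times n$ matrices is called SDC (simultaneously diagonalizable by congruence) if there is an invertible $X\in\mathbb{R}^{n\times n}$ such that $X^TA_kX$ is diagonal for every $k=1,\ldots,d$. For $\mu\in\mathbb{R}^d$, $A(\mu):=\mu_1A_1+\cdots+\mu_dA_d$. "Almost every" is with respect to Lebesgue measure. *)

theory Defs
  imports "HOL-Analysis.Analysis"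
begin

definition symmetric_matrix :: "real^'n^'n \<Rightarrow> bool" where
  "symmetric_matrix M \<longleftrightarrow> transpose M = M"

definition diagonal_matrix :: "real^'n^'n \<Rightarrow> bool" where
  "diagonal_matrix M \<longleftrightarrow> (\<forall>i j. i \<noteq> j \<longrightarrow> M $ i $ j = 0)"

(* Simultaneous diagonalizability by congruence; the family is indexed by a finite type. *)
definition SDC :: "('d::finite \<Rightarrow> real^'n^'n) \<Rightarrow> bool" where
  "SDC A \<longleftrightarrow> (\<exists>X :: real^'n^'n. invertible X \<and> (\<forall>k. diagonal_matrix (transpose X ** A k ** X)))"

definition lin_comb :: "('d::finite \<Rightarrow> real^'n^'n) \<Rightarrow> real^'d \<Rightarrow> real^'n^'n" where
  "lin_comb A \<mu> = (\<Sum>k\<in>UNIV. (\<mu> $ k) *\<^sub>R A k)"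

end

theory Submission
  imports Defs
begin

text \<open>
  Let \<open>S\<close> diagonalize the family and write \<open>v\<^sub>i \<in> \<real>\<^sup>d\<close> for the vector that collects the
  \<open>i\<close>-th diagonal entries of all the matrices \<open>S\<^sup>T A\<^sub>k S\<close>. Then \<open>S\<^sup>T A(\<mu>) S\<close> is diagonal with
  entries \<open>a\<^sub>i = v\<^sub>i \<bullet> \<mu>\<close>, and \<open>S\<^sup>T A(\<theta>) S\<close> is diagonal with entries \<open>b\<^sub>i = v\<^sub>i \<bullet> \<theta>\<close>.

  The pair \<open>(\<mu>, \<theta>)\<close> is called generic when these numbers reveal which \<open>v\<^sub>i\<close> vanish and which
  are parallel: \<open>a\<^sub>i = 0\<close> forces \<open>v\<^sub>i = 0\<close>, and \<open>a\<^sub>i b\<^sub>j = a\<^sub>j b\<^sub>i\<close> forces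
  \<open>a\<^sub>i v\<^sub>j = a\<^sub>j v\<^sub>i\<close>. Almost every pair is generic, because for fixed \<open>\<mu>\<close> the equation
  \<open>a\<^sub>i b\<^sub>j = a\<^sub>j b\<^sub>i\<close> says that \<open>\<theta>\<close> is orthogonal to \<open>a\<^sub>i v\<^sub>j - a\<^sub>j v\<^sub>i\<close>; if this vector is
  nonzero, this is a null set of \<open>\<theta>\<close> (lemma \<open>AE_generic\<close>).

  Now let \<open>X = S Z\<close> diagonalize both \<open>A(\<mu>)\<close> and \<open>A(\<theta>)\<close>, and let \<open>z\<close> be a column of \<open>Z\<close>, with
  diagonal entries \<open>\<kappa>\<close> and \<open>m\<close> in the two diagonalized matrices. The vector with coordinates
  \<open>(m a\<^sub>i - \<kappa> b\<^sub>i) z\<^sub>i\<close> is orthogonal to every column of \<open>Z\<close>, hence zero. So the pairs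
  \<open>(a\<^sub>i, b\<^sub>i)\<close> with \<open>z\<^sub>i \<noteq> 0\<close> are all multiples of \<open>(\<kappa>, m)\<close> (unless \<open>\<kappa> = 0\<close>, a case in
  which \<open>v\<^sub>i = 0\<close> on the support of \<open>z\<close>). By genericity the \<open>v\<^sub>i\<close> on the support of \<open>z\<close>
  are then the multiples \<open>a\<^sub>i c\<close> of one vector \<open>c\<close>: on \<open>z\<close> the \<open>k\<close>-th matrix acts as
  \<open>c\<^sub>k\<close> times \<open>A(\<mu>)\<close> does, so it inherits the orthogonality of \<open>z\<close> to the other columns
  (lemma \<open>generic_congruence\<close>).
\<close>

section \<open>Generic pairs of parameters\<close>

text \<open>
  Parallelism of \<open>v i\<close> and \<open>v j\<close> appears through the one vector
  \<open>(v i \<bullet> \<mu>) *\<^sub>R v j - (v j \<bullet> \<mu>) *\<^sub>R v i\<close>: it is orthogonal to \<open>\<mu>\<close> by construction, and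
  the second clause says that it is orthogonal to \<open>\<theta>\<close> only if it vanishes.
\<close>

definition generic :: "('n \<Rightarrow> real^'d) \<Rightarrow> real^'d \<Rightarrow> real^'d \<Rightarrow> bool" where
  "generic v \<mu> \<theta> \<longleftrightarrow>
     (\<forall>i. v i \<bullet> \<mu> = 0 \<longrightarrow> v i = 0) \<and>
     (\<forall>i j. (v i \<bullet> \<mu>) * (v j \<bullet> \<theta>) = (v j \<bullet> \<mu>) * (v i \<bullet> \<theta>) \<longrightarrow>
            (v i \<bullet> \<mu>) *\<^sub>R v j = (v j \<bullet> \<mu>) *\<^sub>R v i)"

lemma AE_not_orthogonal:
  fixes w :: "'a::euclidean_space"
  shows "AE x in lborel. w \<bullet> x = 0 \<longrightarrow> w = 0"
proof (cases "w = 0")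
  case False
  have "negligible {x. w \<bullet> x = 0}"
    using negligible_hyperplane[of w 0] False by simp
  moreover have "closed {x. w \<bullet> x = 0}"
    by (rule closed_hyperplane)
  ultimately have "{x. w \<bullet> x = 0} \<in> null_sets lborel"
    by (simp add: negligible_iff_null_sets null_sets_completion_iff)
  then have "AE x in lborel. x \<notin> {x. w \<bullet> x = 0}"
    by (rule AE_not_in)
  then show ?thesis by eventually_elim simp
qed simp

text \<open>
  By Fubini it suffices that for each fixed \<open>\<mu>\<close> outside the finitely many hyperplanes
  orthogonal to some \<open>v i \<noteq> 0\<close>, almost every \<open>\<theta>\<close> is good; both families of exceptional sets
  consist of hyperplanes.
\<close>

lemma AE_generic:
  fixes v :: "'n::finite \<Rightarrow> real^'d"
  shows "AE p in lebesgue. generic v (fst p) (snd p)"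
proof -
  let ?w = "\<lambda>\<mu> i j. (v i \<bullet> \<mu>) *\<^sub>R v j - (v j \<bullet> \<mu>) *\<^sub>R v i"
  have eq: "generic v \<mu> \<theta> \<longleftrightarrow>
      (\<forall>i. v i \<bullet> \<mu> = 0 \<longrightarrow> v i = 0) \<and> (\<forall>i j. ?w \<mu> i j \<bullet> \<theta> = 0 \<longrightarrow> ?w \<mu> i j = 0)" for \<mu> \<theta>
    by (simp add: generic_def inner_diff_left)
  have "AE \<mu> in lborel. \<forall>i. v i \<bullet> \<mu> = 0 \<longrightarrow> v i = 0"
    by (simp only: AE_all_countable) (simp only: AE_not_orthogonal simp_thms)
  then have slices: "AE \<mu> in lborel. AE \<theta> in lborel. generic v \<mu> \<theta>"
  proof eventually_elim
    case (elim \<mu>)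
    have "AE \<theta> in lborel. \<forall>i j. ?w \<mu> i j \<bullet> \<theta> = 0 \<longrightarrow> ?w \<mu> i j = 0"
      by (simp only: AE_all_countable) (simp only: AE_not_orthogonal simp_thms)
    then show ?case
      unfolding eq by eventually_elim (use elim in blast)
  qed
  have "AE p in lborel \<Otimes>\<^sub>M lborel. generic v (fst p) (snd p)"
  proof (rule lborel_pair.AE_pair_measure)
    \<comment> \<open>Every clause is a Boolean combination of closed conditions, so the set is Borel.\<close>
    have "{p. generic v (fst p) (snd p)} =
        (\<Inter>i. - {p. v i \<bullet> fst p = 0} \<union> {p. v i = 0}) \<inter>
        (\<Inter>i. \<Inter>j. - {p. (v i \<bullet> fst p) * (v j \<bullet> snd p) = (v j \<bullet> fst p) * (v i \<bullet> snd p)}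
                \<union> {p. (v i \<bullet> fst p) *\<^sub>R v j = (v j \<bullet> fst p) *\<^sub>R v i})"
      by (auto simp: generic_def split: if_splits)
    also have "\<dots> \<in> sets borel"
    proof (intro sets.Int sets.countable_INT'' sets.Un borel_comp borel_closed)
      show "closed {p. (v i \<bullet> fst p) * (v j \<bullet> snd p) = (v j \<bullet> fst p) * (v i \<bullet> snd p)}" for i j
        by (intro closed_Collect_eq continuous_intros)
      show "closed {p. (v i \<bullet> fst p) *\<^sub>R v j = (v j \<bullet> fst p) *\<^sub>R v i}" for i j
        by (intro closed_Collect_eq continuous_intros)
      show "closed {p. v i \<bullet> fst p = 0}" for i
        by (intro closed_Collect_eq continuous_intros)
    qed simp_all
    finally show "{p \<in> space (lborel \<Otimes>\<^sub>M lborel). generic v (fst p) (snd p)}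
            \<in> sets (lborel \<Otimes>\<^sub>M lborel)"
      by (simp only: lborel_prod sets_lborel space_lborel space_borel UNIV_I simp_thms)
  qed (use slices in simp)
  then have "AE p in lborel. generic v (fst p) (snd p)"
    by (simp only: lborel_prod)
  then show ?thesis by (rule AE_completion)
qed

section \<open>Congruence of diagonal matrices\<close>

lemma congruence_diagonal_entry:
  fixes D Z :: "real^'n^'n"
  assumes "diagonal_matrix D"
  shows "(transpose Z ** D ** Z) $ l $ j = (\<Sum>i\<in>UNIV. D $ i $ i * Z $ i $ l * Z $ i $ j)"
proof -
  have "(\<Sum>r\<in>UNIV. Z $ r $ l * D $ r $ i) = Z $ i $ l * D $ i $ i" for i
    using assms by (subst sum.remove[of _ i]) (auto simp: diagonal_matrix_def)
  then show ?thesis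
    by (simp add: matrix_matrix_mult_def transpose_def mult_ac)
qed

lemma orthogonal_to_columns_imp_zero:
  fixes Z :: "real^'n^'n"
  assumes inv: "invertible Z" and orth: "\<And>l. (\<Sum>i\<in>UNIV. u i * Z $ i $ l) = 0"
  shows "u i = 0"
proof -
  have "(\<chi> i. u i) v* Z = 0"
    using orth by (simp add: vector_matrix_mult_def vec_eq_iff mult.commute)
  moreover obtain Z' where "Z ** Z' = mat 1"
    using inv by (auto simp: invertible_def)
  ultimately have "(\<chi> i. u i) = 0"
    by (metis vector_matrix_mul_assoc vector_matrix_mult_0 vector_matrix_mul_rid)
  then show ?thesis by (simp add: vec_eq_iff)
qed

text \<open>
  The heart of the argument: on the \<open>j\<close>-th column of \<open>Z\<close>, each diagonal matrix with entries
  \<open>v i $ k\<close> is a scalar multiple of the one with entries \<open>v i \<bullet> \<mu>\<close>, so both make this column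
  orthogonal to the others.
\<close>

lemma generic_congruence:
  fixes Z :: "real^'n^'n" and v :: "'n \<Rightarrow> real^'d"
  assumes inv: "invertible Z" and gen: "generic v \<mu> \<theta>"
    and diag_\<mu>: "\<And>l j. l \<noteq> j \<Longrightarrow> (\<Sum>i\<in>UNIV. (v i \<bullet> \<mu>) * Z $ i $ l * Z $ i $ j) = 0"
    and diag_\<theta>: "\<And>l j. l \<noteq> j \<Longrightarrow> (\<Sum>i\<in>UNIV. (v i \<bullet> \<theta>) * Z $ i $ l * Z $ i $ j) = 0"
    and "l \<noteq> j"
  shows "(\<Sum>i\<in>UNIV. v i $ k * Z $ i $ l * Z $ i $ j) = 0"
proof -
  define a where "a i = v i \<bullet> \<mu>" for i
  define b where "b i = v i \<bullet> \<theta>" for i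
  define \<kappa> where "\<kappa> = (\<Sum>i\<in>UNIV. a i * Z $ i $ j * Z $ i $ j)"
  define m where "m = (\<Sum>i\<in>UNIV. b i * Z $ i $ j * Z $ i $ j)"
  have "\<exists>c. \<forall>i. v i $ k * Z $ i $ j = c * (a i * Z $ i $ j)"
  proof (cases "\<kappa> = 0")
    case True
    \<comment> \<open>The first diagonal matrix kills the column, so by genericity all of them do.\<close>
    have "(\<Sum>i\<in>UNIV. (a i * Z $ i $ j) * Z $ i $ r) = 0" for r
      using diag_\<mu>[of r j] True by (cases "r = j") (auto simp: a_def \<kappa>_def mult_ac)
    then have "a i * Z $ i $ j = 0" for i
      by (rule orthogonal_to_columns_imp_zero[OF inv])
    then have "v i $ k * Z $ i $ j = 0" for i
      using gen by (metis a_def generic_def mult_eq_0_iff zero_index)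
    then show ?thesis by (intro exI[of _ 0]) simp
  next
    case False
    \<comment> \<open>With multipliers \<open>m\<close> and \<open>\<kappa>\<close> the diagonal entries, the case \<open>r = j\<close>, cancel as well.\<close>
    have "(\<Sum>i\<in>UNIV. ((m * a i - \<kappa> * b i) * Z $ i $ j) * Z $ i $ r) = 0" for r
    proof -
      have "(\<Sum>i\<in>UNIV. ((m * a i - \<kappa> * b i) * Z $ i $ j) * Z $ i $ r)
          = m * (\<Sum>i\<in>UNIV. a i * Z $ i $ r * Z $ i $ j)
            - \<kappa> * (\<Sum>i\<in>UNIV. b i * Z $ i $ r * Z $ i $ j)"
        by (simp add: sum_distrib_left sum_subtractf[symmetric] algebra_simps)
      also have "\<dots> = 0"
        using diag_\<mu>[of r j] diag_\<theta>[of r j]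
        by (cases "r = j") (simp_all add: a_def b_def \<kappa>_def m_def)
      finally show ?thesis .
    qed
    then have "(m * a i - \<kappa> * b i) * Z $ i $ j = 0" for i
      by (rule orthogonal_to_columns_imp_zero[OF inv])
    then have ratio: "\<kappa> * b i = m * a i" if "Z $ i $ j \<noteq> 0" for i
      using that by (metis mult_eq_0_iff right_minus_eq)
    obtain s where s: "a s \<noteq> 0" "Z $ s $ j \<noteq> 0"
      using False unfolding \<kappa>_def by (metis (no_types, lifting) mult_eq_0_iff sum.neutral)
    have "v i $ k = v s $ k / a s * a i" if "Z $ i $ j \<noteq> 0" for i
    proof -
      have "\<kappa> * (a s * b i) = a s * (\<kappa> * b i)"
        by (rule mult.left_commute)
      also have "\<dots> = a i * (\<kappa> * b s)"
        by (simp add: ratio[OF that] ratio[OF s(2)])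
      also have "\<dots> = \<kappa> * (a i * b s)"
        by (rule mult.left_commute)
      finally have "\<kappa> * (a s * b i) = \<kappa> * (a i * b s)" .
      then have "a s * b i = a i * b s"
        using False by simp
      then have "a s *\<^sub>R v i = a i *\<^sub>R v s"
        using gen by (simp add: generic_def a_def b_def)
      then have "a s * v i $ k = a i * v s $ k"
        by (metis real_scaleR_def vector_scaleR_component)
      then show ?thesis
        using s(1) by (simp add: field_simps)
    qed
    then show ?thesis
      by (intro exI[of _ "v s $ k / a s"]) (metis mult.assoc mult_zero_right)
  qed
  then obtain c where c: "v i $ k * Z $ i $ j = c * (a i * Z $ i $ j)" for i
    by blast
  have "v i $ k * Z $ i $ l * Z $ i $ j = c * (a i * Z $ i $ l * Z $ i $ j)" for i
    using arg_cong[OF c[of i], of "\<lambda>x. x * Z $ i $ l"] by (simp add: mult_ac)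
  then have "(\<Sum>i\<in>UNIV. v i $ k * Z $ i $ l * Z $ i $ j)
      = c * (\<Sum>i\<in>UNIV. a i * Z $ i $ l * Z $ i $ j)"
    by (simp only: sum_distrib_left)
  then show ?thesis
    using diag_\<mu>[OF \<open>l \<noteq> j\<close>] by (simp add: a_def)
qed

section \<open>Reduction to the diagonal family\<close>

lemma congruence_lin_comb:
  fixes A :: "'d::finite \<Rightarrow> real^'n^'n"
  shows "transpose S ** lin_comb A \<mu> ** S = lin_comb (\<lambda>k. transpose S ** A k ** S) \<mu>"
proof -
  have lin: "linear (\<lambda>M. transpose S ** M ** S)"
  proof (rule linearI)
    show "transpose S ** (M + N) ** S = transpose S ** M ** S + transpose S ** N ** S" for M N
      by (simp add: vec_eq_iff matrix_matrix_mult_def distrib_left distrib_right sum.distrib)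
    show "transpose S ** (c *\<^sub>R M) ** S = c *\<^sub>R (transpose S ** M ** S)" for c M
      by (simp add: matrix_scalar_ac flip: scalar_matrix_assoc)
  qed
  show ?thesis
    by (simp add: lin_comb_def linear_sum[OF lin] linear_scale[OF lin])
qed

lemma lin_comb_entry: "lin_comb A \<mu> $ i $ j = (\<chi> k. A k $ i $ j) \<bullet> \<mu>"
  by (simp add: lin_comb_def inner_vec_def mult.commute)

theorem theorem7:
  fixes A :: "'d::finite \<Rightarrow> real^'n^'n"
  assumes "\<And>k. symmetric_matrix (A k)"
    and "SDC A"
  shows "AE (\<mu>, \<theta>) in (lebesgue :: ((real^'d) \<times> (real^'d)) measure).
           \<forall>X :: real^'n^'n.
             invertible X \<longrightarrow>
             diagonal_matrix (transpose X ** lin_comb A \<mu> ** X) \<longrightarrow>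
             diagonal_matrix (transpose X ** lin_comb A \<theta> ** X) \<longrightarrow>
             (\<forall>k. diagonal_matrix (transpose X ** A k ** X))"
proof -
  obtain S :: "real^'n^'n" where S: "invertible S"
    and diag: "\<And>k. diagonal_matrix (transpose S ** A k ** S)"
    using assms(2) by (auto simp: SDC_def)
  define D where "D k = transpose S ** A k ** S" for k
  define v where "v i = (\<chi> k. D k $ i $ i)" for i
  have D: "diagonal_matrix (D k)" for k
    using diag by (simp add: D_def)
  have D_lin: "diagonal_matrix (lin_comb D \<nu>)" for \<nu>
    using D by (simp add: diagonal_matrix_def lin_comb_entry inner_vec_def)
  have main: "diagonal_matrix (transpose X ** A k ** X)"
    if gen: "generic v \<mu> \<theta>" and X: "invertible X"
      and \<mu>: "diagonal_matrix (transpose X ** lin_comb A \<mu> ** X)"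
      and \<theta>: "diagonal_matrix (transpose X ** lin_comb A \<theta> ** X)"
    for \<mu> \<theta> k and X :: "real^'n^'n"
  proof -
    obtain S' where S': "S ** S' = mat 1" "S' ** S = mat 1"
      using S by (auto simp: invertible_def)
    define Z where "Z = S' ** X"
    have "invertible S'"
      using S' by (auto simp: invertible_def)
    then have Z: "invertible Z"
      unfolding Z_def using X by (rule invertible_mult)
    have "X = S ** Z"
      by (simp add: Z_def matrix_mul_assoc S')
    then have conj: "transpose X ** M ** X = transpose Z ** (transpose S ** M ** S) ** Z" for M
      by (simp add: matrix_transpose_mul matrix_mul_assoc)
    have entry: "(transpose X ** lin_comb A \<nu> ** X) $ l $ j
        = (\<Sum>i\<in>UNIV. (v i \<bullet> \<nu>) * Z $ i $ l * Z $ i $ j)" for \<nu> l j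
      using congruence_diagonal_entry[OF D_lin]
      by (simp add: conj congruence_lin_comb lin_comb_entry v_def flip: D_def)
    have entry_k: "(transpose X ** A k ** X) $ l $ j
        = (\<Sum>i\<in>UNIV. v i $ k * Z $ i $ l * Z $ i $ j)" for l j
      using congruence_diagonal_entry[OF D] by (simp add: conj v_def flip: D_def)
    show ?thesis
      unfolding diagonal_matrix_def entry_k
      using generic_congruence[OF Z gen] \<mu> \<theta> unfolding diagonal_matrix_def entry by blast
  qed
  show ?thesis
    using AE_generic[of v] by eventually_elim (auto intro: main)
qed

end
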